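(* For every positive integer $n$, the odd graph $O_n$ satisfies the total coloring conjecture, i.e. $\chi''(O_n)\le\Delta(O_n)+2$, where $\Delta(O_n)$ is the maximum degree of $O_n$.
   Context: All graphs are finite, simple and undirected. A total coloring of a graph $G$ is a map $f: V(G)\cup E(G)\to C$ ($C$ a set of colors) such that adjacent vertices receive different colors, edges sharing an endpoint receive different colors, and every edge receives a color different from those of its two endpoints. The total chromatic number $\chi''(G)$ is the minimum number of colors in a total coloring of $G$. The odd graph $O_n$ is the graph whose vertices are the $(n-1)$-element subsets of a fixed $(2n-1)$-element set, two distinct vertices being adjacent if and only if the corresponding subsets are disjoint. *)

theory Defs
  imports Main
begin

record 'a ugraph =
  verts :: "'a set"
  edges :: "'a set set"

definition simple_graph :: "'a ugraph \<Rightarrow> bool" where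
  "simple_graph G \<longleftrightarrow> finite (verts G) \<and> (\<forall>e\<in>edges G. e \<subseteq> verts G \<and> card e = 2)"

definition degree :: "'a ugraph \<Rightarrow> 'a \<Rightarrow> nat" where
  "degree G v = card {e \<in> edges G. v \<in> e}"

definition max_degree :: "'a ugraph \<Rightarrow> nat" where
  "max_degree G = Max (degree G ` verts G)"

text \<open>
  The domain of a total coloring is the disjoint union of vertices and edges; the
  vertex \<open>v\<close> is \<open>Inl v\<close> and the edge \<open>e\<close> is \<open>Inr e\<close>.
\<close>

definition total_coloring :: "'a ugraph \<Rightarrow> 'c set \<Rightarrow> ('a + 'a set \<Rightarrow> 'c) \<Rightarrow> bool" where
  "total_coloring G C f \<longleftrightarrow>
     f ` (verts G <+> edges G) \<subseteq> C \<and>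
     (\<forall>u\<in>verts G. \<forall>v\<in>verts G. {u, v} \<in> edges G \<longrightarrow> f (Inl u) \<noteq> f (Inl v)) \<and>
     (\<forall>e\<in>edges G. \<forall>e'\<in>edges G. e \<noteq> e' \<and> e \<inter> e' \<noteq> {} \<longrightarrow> f (Inr e) \<noteq> f (Inr e')) \<and>
     (\<forall>e\<in>edges G. \<forall>v\<in>e. f (Inr e) \<noteq> f (Inl v))"

text \<open>
  Natural numbers serve as colors: every finite set of colors can be replaced by a set of
  natural numbers of the same size. The minimum exists for every simple graph, by
  \<open>total_coloring_exists\<close> below.
\<close>

definition total_chromatic_number :: "'a ugraph \<Rightarrow> nat" where
  "total_chromatic_number G =
     (LEAST k. \<exists>(C :: nat set) f. finite C \<and> card C = k \<and> total_coloring G C f)"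

text \<open>
  The distinctness condition matters only for \<open>n = 1\<close>, where the unique vertex is the empty
  set, which is disjoint from itself.
\<close>

definition odd_graph :: "nat \<Rightarrow> 'a set \<Rightarrow> 'a set ugraph" where
  "odd_graph n S =
     (let V = {A. A \<subseteq> S \<and> card A = n - 1}
      in \<lparr>verts = V, edges = {{A, B} | A B. A \<in> V \<and> B \<in> V \<and> A \<noteq> B \<and> A \<inter> B = {}}\<rparr>)"

lemma simple_graph_odd_graph:
  assumes "finite S"
  shows "simple_graph (odd_graph n S)"
  using assms by (auto simp: simple_graph_def odd_graph_def Let_def card_2_iff)

lemma finite_edges:
  assumes "simple_graph G"
  shows "finite (edges G)"
proof (rule finite_subset)
  show "edges G \<subseteq> Pow (verts G)" and "finite (Pow (verts G))"
    using assms by (auto simp: simple_graph_def)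
qed

lemma total_coloring_exists:
  assumes "simple_graph G"
  shows "\<exists>(C :: nat set) f. finite C \<and> total_coloring G C f"
proof -
  let ?D = "verts G <+> edges G"
  have fin: "finite ?D"
    using assms finite_edges[OF assms] by (auto simp: simple_graph_def)
  then obtain f :: "'a + 'a set \<Rightarrow> nat" where inj: "inj_on f ?D"
    using finite_imp_inj_to_nat_seg by metis
  have neq: "f x \<noteq> f y" if "x \<in> ?D" "y \<in> ?D" "x \<noteq> y" for x y
    using inj that by (auto dest: inj_onD)
  have loopfree: "u \<noteq> v" if "{u, v} \<in> edges G" for u v
    using assms that by (force simp: simple_graph_def)
  have "total_coloring G (f ` ?D) f"
    unfolding total_coloring_def
  proof (intro conjI ballI impI)
    fix u v assume "u \<in> verts G" "v \<in> verts G" "{u, v} \<in> edges G"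
    then show "f (Inl u) \<noteq> f (Inl v)"
      using loopfree by (intro neq) auto
  next
    fix e e' assume "e \<in> edges G" "e' \<in> edges G" "e \<noteq> e' \<and> e \<inter> e' \<noteq> {}"
    then show "f (Inr e) \<noteq> f (Inr e')"
      by (intro neq) auto
  next
    fix e v assume "e \<in> edges G" "v \<in> e"
    then show "f (Inr e) \<noteq> f (Inl v)"
      using assms by (intro neq) (auto simp: simple_graph_def)
  qed simp
  then show ?thesis
    using fin by blast
qed

end

theory Submission
  imports Defs
begin

text \<open>
  Fix a point \<open>r\<close> of \<open>S\<close>. The vertices containing \<open>r\<close> are independent, and the edges between
  vertices avoiding \<open>r\<close> form the perfect matching \<open>Q \<leftrightarrow> S - Q - {r}\<close> on those vertices. Both the
  former vertices and the latter edges can therefore receive the single color \<open>n\<close>. The remaining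
  edges \<open>{P, Q}\<close> with \<open>r \<in> P\<close> form a bipartite graph, which is properly colored with the
  \<open>n\<close> colors \<open>0, \<dots>, n - 1\<close> by an explicit modular rule going back to Duffus, Kierstead and Snevily.
  A vertex \<open>Q\<close> avoiding \<open>r\<close> has degree \<open>n - 1\<close> in that graph, hence misses one of these colors.
  In each pair of the perfect matching, one vertex gets color \<open>n + 1\<close> and the other its missing
  color.
\<close>

section \<open>Injectivity of levels modulo \<open>n\<close>\<close>

lemma mod_neq_if_close:
  fixes i j n :: nat
  assumes "i < j" "j < i + n"
  shows "i mod n \<noteq> j mod n"
proof
  assume "i mod n = j mod n"
  then have "n dvd j - i"
    using assms by (metis less_imp_le_nat mod_eq_dvd_iff_nat)
  then show False
    using assms by (auto dest: dvd_imp_le)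
qed

text \<open>
  With \<open>S - (P \<union> Q) = {x}\<close> and \<open>r \<in> P\<close>, the edge \<open>{P, Q}\<close> gets the color \<open>level h T x mod n\<close>, where
  \<open>T = S - Q = P \<union> {x}\<close> and \<open>h\<close> numbers the points of \<open>S\<close>. For fixed \<open>Q\<close> only the counting term varies,
  over \<open>0, \<dots>, n - 1\<close>; the value at \<open>x = r\<close> is the color missing at \<open>Q\<close>. For fixed \<open>P\<close> the level
  increases by \<open>1\<close> from each point of \<open>S - P\<close> to the next.
\<close>

definition level :: "('a \<Rightarrow> nat) \<Rightarrow> 'a set \<Rightarrow> 'a \<Rightarrow> nat" where
  "level h T x = sum h T + card {a \<in> T. h x < h a}"

text \<open>The sum is constant on \<open>T\<close>, and the counting term strictly decreases along
  \<open>h\<close> with values below \<open>card T\<close>, so levels of distinct points differ by a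
  positive amount less than \<open>n\<close>.\<close>

lemma inj_on_level_mod:
  assumes "finite T" "inj_on h T" "card T \<le> n"
  shows "inj_on (\<lambda>x. level h T x mod n) T"
proof -
  have neq: "level h T x mod n \<noteq> level h T y mod n" if "x \<in> T" "y \<in> T" "h x < h y" for x y
  proof -
    have "card {a \<in> T. h y < h a} < card {a \<in> T. h x < h a}"
      using assms(1) that by (intro psubset_card_mono) (auto simp: psubset_eq)
    moreover have "card {a \<in> T. h x < h a} < card T"
      using assms(1) that by (intro psubset_card_mono) auto
    ultimately show ?thesis
      using assms(3) mod_neq_if_close[of "level h T y" "level h T x" n]
      by (auto simp: level_def)
  qed
  show ?thesis
  proof (rule inj_onI)
    fix x y assume xy: "x \<in> T" "y \<in> T" "level h T x mod n = level h T y mod n"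
    then have "h x = h y"
      using neq[of x y] neq[of y x] by (metis linorder_neqE_nat)
    then show "x = y"
      using assms(2) xy by (auto dest: inj_onD)
  qed
qed

lemma level_insert:
  assumes "finite P" "x \<notin> P"
  shows "level h (insert x P) x = h x + sum h P + card {a \<in> P. h x < h a}"
proof -
  have "{a \<in> insert x P. h x < h a} = {a \<in> P. h x < h a}"
    by auto
  then show ?thesis
    using assms by (simp add: level_def)
qed

text \<open>Passing from \<open>x\<close> up to \<open>y\<close> adds \<open>h y - h x\<close> and
  drops from the count the points of \<open>P\<close> in between. The net gain is the number of
  points of \<open>S - P\<close> above \<open>x\<close> and up to \<open>y\<close>.\<close>

lemma inj_on_level_insert_mod:
  assumes h: "bij_betw h S {..<m}" and P: "P \<subseteq> S" "card (S - P) \<le> n"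
  shows "inj_on (\<lambda>x. level h (insert x P) x mod n) (S - P)"
proof -
  have "finite S"
    using bij_betw_finite[OF h] by simp
  with P(1) have fin: "finite S" "finite P"
    by (auto dest: finite_subset)
  have neq: "level h (insert x P) x mod n \<noteq> level h (insert y P) y mod n"
    if x: "x \<in> S - P" and y: "y \<in> S - P" and less: "h x < h y" for x y
  proof -
    define D where "D = {z \<in> S - P. h x < h z \<and> h z \<le> h y}"
    define E where "E = {z \<in> P. h x < h z \<and> h z \<le> h y}"
    have DE: "D \<union> E = {z \<in> S. h x < h z \<and> h z \<le> h y}"
      using P(1) by (auto simp: D_def E_def)
    \<comment> \<open>As \<open>h\<close> maps onto an initial segment, every number up to
      \<open>h y\<close> labels a point of \<open>S\<close>.\<close>
    have "h y < m"
      using bij_betwE[OF h] y by auto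
    then have "{h x<..h y} \<subseteq> h ` S"
      using h by (auto simp: bij_betw_def)
    then have "h ` (D \<union> E) = {h x<..h y}"
      unfolding DE by fastforce
    moreover have "inj_on h (D \<union> E)"
      using inj_on_subset[OF bij_betw_imp_inj_on[OF h]] by (simp add: DE)
    ultimately have "card (D \<union> E) = h y - h x"
      using card_image[of h "D \<union> E"] by simp
    moreover have "card (D \<union> E) = card D + card E"
      using fin by (intro card_Un_disjoint) (auto simp: D_def E_def)
    moreover have "{a \<in> P. h x < h a} = E \<union> {a \<in> P. h y < h a}"
      using less by (auto simp: E_def)
    moreover have "card (E \<union> {a \<in> P. h y < h a}) = card E + card {a \<in> P. h y < h a}"
      using fin by (intro card_Un_disjoint) (auto simp: E_def)
    ultimately have eq: "level h (insert y P) y = level h (insert x P) x + card D"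
      using fin x y less by (simp add: level_insert)
    have "y \<in> D" "finite D"
      using fin y less by (auto simp: D_def)
    then have "card D > 0"
      by (auto simp: card_gt_0_iff)
    \<comment> \<open>The inclusion is strict because \<open>D\<close> omits
      \<open>x\<close>.\<close>
    moreover have "card D < card (S - P)"
      using fin x by (intro psubset_card_mono) (auto simp: D_def)
    ultimately show ?thesis
      using P(2) by (intro mod_neq_if_close) (auto simp: eq)
  qed
  show ?thesis
  proof (rule inj_onI)
    fix x y assume xy: "x \<in> S - P" "y \<in> S - P"
      "level h (insert x P) x mod n = level h (insert y P) y mod n"
    then have "h x = h y"
      using neq[of x y] neq[of y x] by (metis linorder_neqE_nat)
    then show "x = y"
      using h xy by (auto simp: bij_betw_def dest: inj_onD)
  qed
qed

section \<open>The total coloring\<close>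

locale odd_graph_coloring =
  fixes n :: nat and S :: "'a set" and h :: "'a \<Rightarrow> nat" and r p :: 'a
  assumes n: "n \<ge> 1"
    and h: "bij_betw h S {..<2 * n - 1}"
    and r: "r \<in> S" and p: "p \<in> S" "p \<noteq> r"
begin

abbreviation V :: "'a set set" where
  "V \<equiv> {A. A \<subseteq> S \<and> card A = n - 1}"

definition missing :: "'a set set \<Rightarrow> 'a" where
  "missing e = the_elem (S - \<Union>e)"

text \<open>The union over the filtered edge extracts the endpoint avoiding \<open>r\<close> without
  ordering the edge.\<close>

definition edge_color :: "'a set set \<Rightarrow> nat" where
  "edge_color e = (if r \<in> \<Union>e then level h (S - \<Union>{B \<in> e. r \<notin> B}) (missing e) mod n else n)"

text \<open>Two matched vertices partition \<open>S - {r}\<close>, so exactly one contains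
  \<open>p\<close>; this selects the one colored \<open>n + 1\<close>.\<close>

definition vertex_color :: "'a set \<Rightarrow> nat" where
  "vertex_color A = (if r \<in> A then n else if p \<in> A then n + 1 else level h (S - A) r mod n)"

lemma finite_S: "finite S"
  using bij_betw_finite[OF h] by simp

lemma card_S: "card S = 2 * n - 1"
  using bij_betw_same_card[OF h] by simp

lemma finite_vertex: "A \<in> V \<Longrightarrow> finite A"
  using finite_subset[OF _ finite_S] by simp

lemma card_Diff_vertex: "A \<in> V \<Longrightarrow> card (S - A) = n"
  using n card_S card_Diff_subset[OF finite_vertex, of A S] by simp

lemma Diff_disjoint_vertices:
  assumes "A \<in> V" "B \<in> V" "A \<inter> B = {}"
  shows "S - (A \<union> B) = {missing {A, B}}"
proof -
  have fin: "finite A" "finite B"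
    using assms finite_vertex by blast+
  have "card (A \<union> B) = (n - 1) + (n - 1)"
    using card_Un_disjoint[OF fin assms(3)] assms(1,2) by simp
  moreover have "card (S - (A \<union> B)) = card S - card (A \<union> B)"
    using fin assms(1,2) by (intro card_Diff_subset) auto
  ultimately have "card (S - (A \<union> B)) = 1"
    using n card_S by linarith
  then obtain x where "S - (A \<union> B) = {x}"
    by (rule card_1_singletonE)
  then show ?thesis
    by (simp add: missing_def)
qed

lemma missing_commute: "missing {A, B} = missing {B, A}"
  by (simp add: insert_commute)

lemma edge_color_commute: "edge_color {A, B} = edge_color {B, A}"
  by (simp add: insert_commute)

lemma edge_color_apex:
  assumes "A \<in> V" "B \<in> V" "A \<inter> B = {}" "r \<in> B"
  shows "edge_color {A, B} = level h (S - A) (missing {A, B}) mod n"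
proof -
  have "{C \<in> {A, B}. r \<notin> C} = {A}"
    using assms by auto
  then show ?thesis
    using assms by (simp add: edge_color_def)
qed

text \<open>Seen from the endpoint containing \<open>r\<close>, the set \<open>T\<close> is that
  endpoint plus the missing point, the form treated by
  \<open>inj_on_level_insert_mod\<close>.\<close>

lemma edge_color_apex':
  assumes "A \<in> V" "B \<in> V" "A \<inter> B = {}" "r \<in> A"
  shows "edge_color {A, B} = level h (insert (missing {A, B}) A) (missing {A, B}) mod n"
proof -
  have "S - B = insert (missing {A, B}) A"
    using Diff_disjoint_vertices[of A B] assms by auto
  then show ?thesis
    using edge_color_apex[of B A] assms
    by (simp add: edge_color_commute missing_commute Int_commute)
qed

lemma edge_color_no_apex: "r \<notin> A \<Longrightarrow> r \<notin> B \<Longrightarrow> edge_color {A, B} = n"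
  by (simp add: edge_color_def)

lemma inj_on_level_Diff: "A \<in> V \<Longrightarrow> inj_on (\<lambda>x. level h (S - A) x mod n) (S - A)"
  using finite_S card_Diff_vertex inj_on_subset[OF bij_betw_imp_inj_on[OF h]]
  by (intro inj_on_level_mod) simp_all

lemma edge_color_neq:
  assumes A: "A \<in> V" and B: "B \<in> V" "A \<inter> B = {}" and B': "B' \<in> V" "A \<inter> B' = {}" and "B \<noteq> B'"
  shows "edge_color {A, B} \<noteq> edge_color {A, B'}"
proof -
  let ?x = "missing {A, B}" and ?x' = "missing {A, B'}"
  note x = Diff_disjoint_vertices[OF A B] and x' = Diff_disjoint_vertices[OF A B']
  \<comment> \<open>A neighbor of \<open>A\<close> is determined by the point missing from the
    edge.\<close>
  have "B = S - A - {?x}" "B' = S - A - {?x'}"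
    using x x' B B' by blast+
  then have neq: "?x \<noteq> ?x'"
    using \<open>B \<noteq> B'\<close> by metis
  have mem: "?x \<in> S - A" "?x' \<in> S - A"
    using x x' by blast+
  have mod_neq: "k mod n \<noteq> n" "k mod n \<noteq> Suc n" for k
    using n mod_less_divisor[of n k] by linarith+
  consider "r \<in> A" | "r \<in> B" "r \<in> B'" | "r \<notin> A" "r \<in> B" "r \<notin> B'" | "r \<notin> A" "r \<notin> B" "r \<in> B'"
    | "r \<notin> A" "r \<notin> B" "r \<notin> B'"
    by blast
  then show ?thesis
  proof cases
    case 1
    have "inj_on (\<lambda>x. level h (insert x A) x mod n) (S - A)"
      using A card_Diff_vertex[OF A] by (intro inj_on_level_insert_mod[OF h]) simp_all
    from inj_on_contraD[OF this neq mem] show ?thesis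
      unfolding edge_color_apex'[OF A B 1] edge_color_apex'[OF A B' 1] .
  next
    case 2
    show ?thesis
      using inj_on_contraD[OF inj_on_level_Diff[OF A] neq mem]
      unfolding edge_color_apex[OF A B 2(1)] edge_color_apex[OF A B' 2(2)] .
  next
    case 3
    then show ?thesis
      using edge_color_apex[OF A B 3(2)] edge_color_no_apex[OF 3(1,3)] mod_neq by simp
  next
    case 4
    then show ?thesis
      using edge_color_apex[OF A B' 4(3)] edge_color_no_apex[OF 4(1,2)] mod_neq(1)[symmetric] by simp
  next
    case 5
    \<comment> \<open>Both edges would lie in the matching and miss \<open>r\<close>, forcing
      \<open>B = B'\<close>.\<close>
    then have "r \<in> S - (A \<union> B)" "r \<in> S - (A \<union> B')"
      using r by simp_all
    then have "?x = r" "?x' = r"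
      by (simp_all add: x x')
    then show ?thesis
      using neq by simp
  qed
qed

lemma edge_color_neq_vertex_color:
  assumes A: "A \<in> V" and B: "B \<in> V" "A \<inter> B = {}"
  shows "edge_color {A, B} \<noteq> vertex_color A"
proof -
  have mod_neq: "k mod n \<noteq> n" "k mod n \<noteq> Suc n" for k
    using n mod_less_divisor[of n k] by linarith+
  consider "r \<in> A" | "r \<notin> A" "r \<in> B" | "r \<notin> A" "r \<notin> B"
    by blast
  then show ?thesis
  proof cases
    case 1
    then show ?thesis
      using edge_color_apex'[OF A B 1] mod_neq by (simp add: vertex_color_def)
  next
    case 2
    \<comment> \<open>As \<open>r\<close> lies in \<open>B\<close>, it is not the missing point, so
      the edge avoids the color kept free at \<open>A\<close>.\<close>
    have "missing {A, B} \<in> S - A" "missing {A, B} \<noteq> r" "r \<in> S - A"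
      using Diff_disjoint_vertices[OF A B] 2 r by blast+
    then have "level h (S - A) (missing {A, B}) mod n \<noteq> level h (S - A) r mod n"
      by (intro inj_on_contraD[OF inj_on_level_Diff[OF A]])
    then show ?thesis
      using 2 mod_neq by (simp add: vertex_color_def edge_color_apex[OF A B 2(2)])
  next
    case 3
    then show ?thesis
      by (simp add: vertex_color_def edge_color_no_apex mod_neq[symmetric])
  qed
qed

lemma vertex_color_neq:
  assumes A: "A \<in> V" and B: "B \<in> V" "A \<inter> B = {}"
  shows "vertex_color A \<noteq> vertex_color B"
proof -
  have neq: "k mod n \<noteq> n" "k mod n \<noteq> Suc n" for k
    using n mod_less_divisor[of n k] by linarith+
  show ?thesis
  proof (cases "r \<in> A \<or> r \<in> B")
    case True
    then show ?thesis
      using B(2) by (auto simp: vertex_color_def neq neq[symmetric])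
  next
    case False
    then have "r \<in> S - (A \<union> B)"
      using r by simp
    with p have "p \<notin> S - (A \<union> B)"
      unfolding Diff_disjoint_vertices[OF A B] by simp
    then have "p \<in> A \<longleftrightarrow> p \<notin> B"
      using p(1) B(2) by blast
    then show ?thesis
      using False by (auto simp: vertex_color_def neq neq[symmetric])
  qed
qed

lemma odd_graph_edgeE:
  assumes "e \<in> edges (odd_graph n S)" "A \<in> e"
  obtains B where "e = {A, B}" "A \<in> V" "B \<in> V" "A \<inter> B = {}"
proof -
  obtain C D where e: "e = {C, D}" "C \<in> V" "D \<in> V" "C \<inter> D = {}"
    using assms(1) by (auto simp: odd_graph_def Let_def)
  then consider "A = C" | "A = D"
    using assms(2) by blast
  then show thesis
  proof cases
    case 1
    then show ?thesis
      using e that by simp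
  next
    case 2
    then show ?thesis
      using e that[of C] by (simp add: insert_commute Int_commute)
  qed
qed

lemma total_coloring_odd_graph:
  "total_coloring (odd_graph n S) {..<n + 2} (case_sum vertex_color edge_color)"
proof -
  have lt: "k mod n < Suc (Suc n)" for k
    using n mod_less_divisor[of n k] by linarith
  show ?thesis
    unfolding total_coloring_def
  proof (intro conjI ballI impI)
    show "case_sum vertex_color edge_color ` (verts (odd_graph n S) <+> edges (odd_graph n S))
        \<subseteq> {..<n + 2}"
      by (auto simp: vertex_color_def edge_color_def lt)
  next
    fix u v assume "{u, v} \<in> edges (odd_graph n S)"
    then obtain B where "{u, v} = {u, B}" "u \<in> V" "B \<in> V" "u \<inter> B = {}"
      by (rule odd_graph_edgeE[OF _ insertI1])
    then have "u \<in> V" "v \<in> V" "u \<inter> v = {}"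
      by (auto simp: doubleton_eq_iff)
    then show "case_sum vertex_color edge_color (Inl u) \<noteq> case_sum vertex_color edge_color (Inl v)"
      unfolding sum.case by (rule vertex_color_neq)
  next
    fix e e' assume e: "e \<in> edges (odd_graph n S)" "e' \<in> edges (odd_graph n S)"
      and ne: "e \<noteq> e' \<and> e \<inter> e' \<noteq> {}"
    then obtain A where "A \<in> e" and "A \<in> e'"
      by auto
    obtain B where "e = {A, B}" "A \<in> V" "B \<in> V" "A \<inter> B = {}"
      using e(1) \<open>A \<in> e\<close> by (rule odd_graph_edgeE)
    moreover obtain B' where "e' = {A, B'}" "B' \<in> V" "A \<inter> B' = {}"
      using e(2) \<open>A \<in> e'\<close> by (rule odd_graph_edgeE)
    moreover from calculation ne have "B \<noteq> B'"
      by blast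
    ultimately show "case_sum vertex_color edge_color (Inr e) \<noteq> case_sum vertex_color edge_color (Inr e')"
      using edge_color_neq[of A B B'] by simp
  next
    fix e A assume "e \<in> edges (odd_graph n S)" "A \<in> e"
    then obtain B where "e = {A, B}" "A \<in> V" "B \<in> V" "A \<inter> B = {}"
      by (rule odd_graph_edgeE)
    then show "case_sum vertex_color edge_color (Inr e) \<noteq> case_sum vertex_color edge_color (Inl A)"
      using edge_color_neq_vertex_color[of A B] by simp
  qed
qed

end

section \<open>A lower bound for the maximum degree\<close>

lemma odd_graph_edgeI:
  assumes "A \<subseteq> S" "card A = n - 1" "B \<subseteq> S" "card B = n - 1" "A \<noteq> B" "A \<inter> B = {}"
  shows "{A, B} \<in> edges (odd_graph n S)"
  using assms unfolding odd_graph_def Let_def by simp blast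

text \<open>Removing any one of the \<open>n\<close> points of \<open>S - A\<close> from
  \<open>S - A\<close> leaves a neighbor of \<open>A\<close>.\<close>

lemma degree_odd_graph_ge:
  assumes n: "n \<ge> 2" and S: "finite S" "card S = 2 * n - 1" and A: "A \<subseteq> S" "card A = n - 1"
  shows "degree (odd_graph n S) A \<ge> n"
proof -
  have card: "card (S - A) = n"
    using n S A(2) card_Diff_subset[OF finite_subset[OF A(1) S(1)] A(1)] by linarith
  let ?f = "\<lambda>x. {A, S - A - {x}}"
  have "inj_on ?f (S - A)"
    unfolding inj_on_def doubleton_eq_iff by blast
  then have "n = card (?f ` (S - A))"
    using card by (simp add: card_image)
  also have "\<dots> \<le> card {e \<in> edges (odd_graph n S). A \<in> e}"
  proof (rule card_mono)
    show "finite {e \<in> edges (odd_graph n S). A \<in> e}"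
      using finite_edges[OF simple_graph_odd_graph[OF S(1)]] by simp
    show "?f ` (S - A) \<subseteq> {e \<in> edges (odd_graph n S). A \<in> e}"
    proof
      fix e assume "e \<in> ?f ` (S - A)"
      then obtain x where x: "x \<in> S - A" "e = {A, S - A - {x}}"
        by auto
      \<comment> \<open>Nonemptiness, from \<open>n \<ge> 2\<close>, turns disjointness into
        distinctness.\<close>
      have "A \<noteq> {}"
        using n A by auto
      then have "A \<noteq> S - A - {x}" "A \<inter> (S - A - {x}) = {}"
        by auto
      moreover have "card (S - A - {x}) = n - 1" "S - A - {x} \<subseteq> S"
        using x card S by auto
      ultimately have "{A, S - A - {x}} \<in> edges (odd_graph n S)"
        by (intro odd_graph_edgeI A) simp_all
      then show "e \<in> {e \<in> edges (odd_graph n S). A \<in> e}"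
        using x(2) by simp
    qed
  qed
  finally show ?thesis
    by (simp add: degree_def)
qed

lemma max_degree_odd_graph_ge:
  assumes "n \<ge> 2" "finite S" "card S = 2 * n - 1"
  shows "max_degree (odd_graph n S) \<ge> n"
proof -
  obtain A where A: "A \<subseteq> S" "card A = n - 1"
    using assms obtain_subset_with_card_n[of "n - 1" S] by force
  then have "A \<in> verts (odd_graph n S)"
    by (simp add: odd_graph_def)
  moreover have "finite (verts (odd_graph n S))"
    using simple_graph_odd_graph[OF assms(2)] by (auto simp: simple_graph_def)
  ultimately have "degree (odd_graph n S) A \<le> max_degree (odd_graph n S)"
    by (simp add: max_degree_def)
  then show ?thesis
    using degree_odd_graph_ge[OF assms A] by simp
qed

lemma total_chromatic_number_le:
  fixes C :: "nat set"
  assumes "finite C" "total_coloring G C f"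
  shows "total_chromatic_number G \<le> card C"
  unfolding total_chromatic_number_def using assms by (intro Least_le) blast

theorem theorem3p2:
  fixes n :: nat and S :: "'a set"
  assumes "n \<ge> 1"
    and "finite S" and "card S = 2 * n - 1"
  shows "total_chromatic_number (odd_graph n S) \<le> max_degree (odd_graph n S) + 2"
proof (cases "n = 1")
  case True
  \<comment> \<open>Here \<open>S\<close> has no second point to serve as \<open>p\<close>, but the
    empty set is the only vertex and one color suffices.\<close>
  have "A = {}" if "A \<subseteq> S" "card A = 0" for A
    using that assms(2) by (metis card_0_eq finite_subset)
  then have "edges (odd_graph n S) = {}"
    using True by (auto simp: odd_graph_def Let_def)
  then have "total_coloring (odd_graph n S) {0 :: nat} (\<lambda>_. 0)"
    by (auto simp: total_coloring_def)
  from total_chromatic_number_le[OF _ this] show ?thesis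
    by simp
next
  case False
  then have n2: "n \<ge> 2"
    using assms(1) by simp
  obtain h where h: "bij_betw h S {..<2 * n - 1}"
    using ex_bij_betw_finite_nat[OF assms(2)] assms(3) by (auto simp: atLeast0LessThan)
  have "\<not> card S \<le> 1"
    using n2 assms(3) by simp
  then obtain r p where "r \<in> S" "p \<in> S" "p \<noteq> r"
    using assms(2) by (metis card_le_Suc0_iff_eq One_nat_def)
  then interpret odd_graph_coloring n S h r p
    using assms(1) h by unfold_locales
  show ?thesis
    using total_chromatic_number_le[OF _ total_coloring_odd_graph]
      max_degree_odd_graph_ge[OF n2 assms(2,3)] by simp
qed

end
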